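(* Every group is (isomorphic to) a subgroup of some group in the class $\mathcal{MZ}$.
   Context: Let $G$ be a group with identity $1$. Pick $x\notin G$ and let $G*\langle x\rangle$ be the free product of $G$ with the infinite cyclic group $\langle x\rangle\cong\mathbb{Z}$ generated by $x$. For $g\in G$ let $\mathrm{ev}_g:G*\langle x\rangle\to G$ be the unique homomorphism which sends $x$ to $g$ and is the identity on $G$. For $w\in G*\langle x\rangle$ put $E_w=\{g\in G:\mathrm{ev}_g(w)=1\}$. The Zariski topology $\mathfrak{Z}_G$ of $G$ is the coarsest topology on $G$ in which all sets $E_w$, $w\in G*\langle x\rangle$, are closed. The Markov topology $\mathfrak{M}_G$ of $G$ is the topology on $G$ whose closed sets are exactly the subsets of $G$ that are closed in every Hausdorff group topology on $G$. $\mathcal{MZ}$ denotes the class of all groups $G$ such that $\mathfrak{M}_G=\mathfrak{Z}_G$. *)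

theory Defs
  imports "HOL-Analysis.Abstract_Topology" "HOL-Analysis.T1_Spaces"
    "HOL-Algebra.Elementary_Groups"
begin

text \<open>The free product is the monoid of words over the disjoint union of the carriers,
  modulo the least congruence that identifies the letters \<open>\<one>\<close> with the empty word
  and multiplies out two neighbouring letters from the same factor.\<close>

abbreviation fp_words :: "('a, 'c) monoid_scheme \<Rightarrow> ('b, 'd) monoid_scheme \<Rightarrow> ('a + 'b) list set"
  where "fp_words G H \<equiv> lists (carrier G <+> carrier H)"

inductive_set fp_rel ::
  "('a, 'c) monoid_scheme \<Rightarrow> ('b, 'd) monoid_scheme \<Rightarrow> (('a + 'b) list \<times> ('a + 'b) list) set"
  for G :: "('a, 'c) monoid_scheme" and H :: "('b, 'd) monoid_scheme"
where
  refl: "u \<in> fp_words G H \<Longrightarrow> (u, u) \<in> fp_rel G H"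
| sym: "(u, v) \<in> fp_rel G H \<Longrightarrow> (v, u) \<in> fp_rel G H"
| trans: "(u, v) \<in> fp_rel G H \<Longrightarrow> (v, w) \<in> fp_rel G H \<Longrightarrow> (u, w) \<in> fp_rel G H"
| one_left: "u \<in> fp_words G H \<Longrightarrow> v \<in> fp_words G H \<Longrightarrow>
    (u @ [Inl \<one>\<^bsub>G\<^esub>] @ v, u @ v) \<in> fp_rel G H"
| one_right: "u \<in> fp_words G H \<Longrightarrow> v \<in> fp_words G H \<Longrightarrow>
    (u @ [Inr \<one>\<^bsub>H\<^esub>] @ v, u @ v) \<in> fp_rel G H"
| mult_left: "u \<in> fp_words G H \<Longrightarrow> v \<in> fp_words G H \<Longrightarrow> a \<in> carrier G \<Longrightarrow> b \<in> carrier G \<Longrightarrow>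
    (u @ [Inl a, Inl b] @ v, u @ [Inl (a \<otimes>\<^bsub>G\<^esub> b)] @ v) \<in> fp_rel G H"
| mult_right: "u \<in> fp_words G H \<Longrightarrow> v \<in> fp_words G H \<Longrightarrow> a \<in> carrier H \<Longrightarrow> b \<in> carrier H \<Longrightarrow>
    (u @ [Inr a, Inr b] @ v, u @ [Inr (a \<otimes>\<^bsub>H\<^esub> b)] @ v) \<in> fp_rel G H"

definition free_product ::
  "('a, 'c) monoid_scheme \<Rightarrow> ('b, 'd) monoid_scheme \<Rightarrow> ('a + 'b) list set monoid"
where
  "free_product G H =
    \<lparr>carrier = fp_words G H // fp_rel G H,
     monoid.mult = (\<lambda>A B. \<Union>u\<in>A. \<Union>v\<in>B. fp_rel G H `` {u @ v}),
     one = fp_rel G H `` {[]}\<rparr>"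

definition fp_inl :: "('a, 'c) monoid_scheme \<Rightarrow> ('b, 'd) monoid_scheme \<Rightarrow> 'a \<Rightarrow> ('a + 'b) list set"
  where "fp_inl G H a = fp_rel G H `` {[Inl a]}"

definition fp_inr :: "('a, 'c) monoid_scheme \<Rightarrow> ('b, 'd) monoid_scheme \<Rightarrow> 'b \<Rightarrow> ('a + 'b) list set"
  where "fp_inr G H b = fp_rel G H `` {[Inr b]}"

lemma fp_rel_words:
  assumes "group G" "group H" "(u, v) \<in> fp_rel G H"
  shows "u \<in> fp_words G H \<and> v \<in> fp_words G H"
  using assms(3)
proof induction
  case (one_left u v)
  then show ?case using assms(1) by (auto intro: group.is_monoid)
next
  case (one_right u v)
  then show ?case using assms(2) by (auto intro: group.is_monoid)
next
  case (mult_left u v a b)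
  then show ?case using assms(1) by (auto simp: group.is_monoid monoid.m_closed)
next
  case (mult_right u v a b)
  then show ?case using assms(2) by (auto simp: group.is_monoid monoid.m_closed)
qed auto

lemma equiv_fp_rel:
  assumes "group G" "group H"
  shows "equiv (fp_words G H) (fp_rel G H)"
proof (rule equivI)
  show "fp_rel G H \<subseteq> fp_words G H \<times> fp_words G H"
    using fp_rel_words[OF assms] by auto
  show "refl_on (fp_words G H) (fp_rel G H)"
    by (rule refl_onI) (auto intro: fp_rel.refl)
  show "sym (fp_rel G H)" by (auto intro!: symI fp_rel.sym)
  show "trans (fp_rel G H)" by (auto intro!: transI intro: fp_rel.trans)
qed

lemma fp_rel_append_context:
  assumes "group G" "group H" "(u, v) \<in> fp_rel G H" "p \<in> fp_words G H" "q \<in> fp_words G H"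
  shows "(p @ u @ q, p @ v @ q) \<in> fp_rel G H"
  using assms(3)
proof induction
  case (refl u)
  then have "p @ u @ q \<in> fp_words G H" using assms(4,5) by simp
  then show ?case by (rule fp_rel.refl)
next
  case (sym u v)
  then show ?case by (blast intro: fp_rel.sym)
next
  case (trans u v w)
  then show ?case by (blast intro: fp_rel.trans)
next
  case (one_left u v)
  then show ?case using fp_rel.one_left[of "p @ u" G H "v @ q"] assms by auto
next
  case (one_right u v)
  then show ?case using fp_rel.one_right[of "p @ u" G H "v @ q"] assms by auto
next
  case (mult_left u v a b)
  then show ?case using fp_rel.mult_left[of "p @ u" G H "v @ q" a b] assms by auto
next
  case (mult_right u v a b)
  then show ?case using fp_rel.mult_right[of "p @ u" G H "v @ q" a b] assms by auto
qed

lemma fp_rel_append: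
  assumes "group G" "group H" "(u, u') \<in> fp_rel G H" "(v, v') \<in> fp_rel G H"
  shows "(u @ v, u' @ v') \<in> fp_rel G H"
proof -
  have w: "u \<in> fp_words G H" "u' \<in> fp_words G H" "v \<in> fp_words G H" "v' \<in> fp_words G H"
    using fp_rel_words[OF assms(1,2)] assms(3,4) by blast+
  have "(u @ v, u' @ v) \<in> fp_rel G H"
    using fp_rel_append_context[OF assms(1,2,3), of "[]" v] w by simp
  moreover have "(u' @ v, u' @ v') \<in> fp_rel G H"
    using fp_rel_append_context[OF assms(1,2,4), of u' "[]"] w by simp
  ultimately show ?thesis by (rule fp_rel.trans)
qed

lemma fp_mult_class:
  assumes "group G" "group H" "u \<in> fp_words G H" "v \<in> fp_words G H"
  shows "fp_rel G H `` {u} \<otimes>\<^bsub>free_product G H\<^esub> fp_rel G H `` {v} = fp_rel G H `` {u @ v}"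
proof -
  note eq = equiv_fp_rel[OF assms(1,2)]
  have "fp_rel G H `` {u' @ v'} = fp_rel G H `` {u @ v}"
    if "u' \<in> fp_rel G H `` {u}" "v' \<in> fp_rel G H `` {v}" for u' v'
    using that fp_rel_append[OF assms(1,2), of u u' v v'] equiv_class_eq[OF eq] by fastforce
  moreover have "u \<in> fp_rel G H `` {u}" "v \<in> fp_rel G H `` {v}"
    using assms fp_rel.refl by blast+
  ultimately show ?thesis unfolding free_product_def monoid.simps by blast
qed

lemma fp_carrierE:
  assumes "A \<in> carrier (free_product G H)"
  obtains u where "u \<in> fp_words G H" "A = fp_rel G H `` {u}"
  using assms by (auto simp: free_product_def quotient_def)

lemma fp_class_carrier:
  "u \<in> fp_words G H \<Longrightarrow> fp_rel G H `` {u} \<in> carrier (free_product G H)"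
  by (auto simp: free_product_def quotient_def)

lemma fp_left_inverse_word:
  assumes "group G" "group H" "u \<in> fp_words G H"
  shows "\<exists>v \<in> fp_words G H. (v @ u, []) \<in> fp_rel G H"
  using assms(3)
proof (induction u)
  case Nil
  then show ?case by (auto intro!: bexI[of _ "[]"] fp_rel.refl)
next
  case (Cons s u)
  then obtain v where v: "v \<in> fp_words G H" "(v @ u, []) \<in> fp_rel G H" by auto
  have u: "u \<in> fp_words G H" using Cons by auto
  obtain t where t: "t \<in> carrier G <+> carrier H" "([t, s], []) \<in> fp_rel G H"
  proof (cases s)
    case (Inl a)
    with Cons have a: "a \<in> carrier G" by auto
    have "([Inl (inv\<^bsub>G\<^esub> a), Inl a], [Inl \<one>\<^bsub>G\<^esub>]) \<in> fp_rel G H"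
      using fp_rel.mult_left[of "[]" G H "[]" "inv\<^bsub>G\<^esub> a" a] a assms(1)
      by (simp add: group.l_inv)
    moreover have "([Inl \<one>\<^bsub>G\<^esub>], []) \<in> fp_rel G H"
      using fp_rel.one_left[of "[]" G H "[]"] by simp
    ultimately show ?thesis
      using that[of "Inl (inv\<^bsub>G\<^esub> a)"] a assms(1) Inl fp_rel.trans by fastforce
  next
    case (Inr a)
    with Cons have a: "a \<in> carrier H" by auto
    have "([Inr (inv\<^bsub>H\<^esub> a), Inr a], [Inr \<one>\<^bsub>H\<^esub>]) \<in> fp_rel G H"
      using fp_rel.mult_right[of "[]" G H "[]" "inv\<^bsub>H\<^esub> a" a] a assms(2)
      by (simp add: group.l_inv)
    moreover have "([Inr \<one>\<^bsub>H\<^esub>], []) \<in> fp_rel G H"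
      using fp_rel.one_right[of "[]" G H "[]"] by simp
    ultimately show ?thesis
      using that[of "Inr (inv\<^bsub>H\<^esub> a)"] a assms(2) Inr fp_rel.trans by fastforce
  qed
  have "((v @ [t]) @ s # u, v @ u) \<in> fp_rel G H"
    using fp_rel_append_context[OF assms(1,2) t(2) v(1) u] by simp
  with v t show ?case
    by (intro bexI[of _ "v @ [t]"]) (auto intro: fp_rel.trans)
qed

lemma group_free_product:
  assumes "group G" "group H"
  shows "group (free_product G H)"
proof (rule groupI)
  note mc = fp_mult_class[OF assms]
  have one: "\<one>\<^bsub>free_product G H\<^esub> = fp_rel G H `` {[]}" by (simp add: free_product_def)
  show "\<one>\<^bsub>free_product G H\<^esub> \<in> carrier (free_product G H)"
    unfolding one by (rule fp_class_carrier) simp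
  fix A assume "A \<in> carrier (free_product G H)"
  then obtain u where u: "u \<in> fp_words G H" "A = fp_rel G H `` {u}" by (rule fp_carrierE)
  show "\<one>\<^bsub>free_product G H\<^esub> \<otimes>\<^bsub>free_product G H\<^esub> A = A"
    unfolding one u(2) using mc[of "[]" u] u by simp
  obtain v where v: "v \<in> fp_words G H" "(v @ u, []) \<in> fp_rel G H"
    using fp_left_inverse_word[OF assms u(1)] by blast
  show "\<exists>B\<in>carrier (free_product G H). B \<otimes>\<^bsub>free_product G H\<^esub> A = \<one>\<^bsub>free_product G H\<^esub>"
    unfolding one u(2)
    using mc[OF v(1) u(1)] equiv_class_eq[OF equiv_fp_rel[OF assms] v(2)] fp_class_carrier[OF v(1)]
    by (intro bexI[of _ "fp_rel G H `` {v}"]) auto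
  fix B assume "B \<in> carrier (free_product G H)"
  then obtain v where v: "v \<in> fp_words G H" "B = fp_rel G H `` {v}" by (rule fp_carrierE)
  show "A \<otimes>\<^bsub>free_product G H\<^esub> B \<in> carrier (free_product G H)"
    unfolding u(2) v(2) using mc[OF u(1) v(1)] fp_class_carrier[of "u @ v" G H] u v by simp
  fix C assume "C \<in> carrier (free_product G H)"
  then obtain w where w: "w \<in> fp_words G H" "C = fp_rel G H `` {w}" by (rule fp_carrierE)
  show "A \<otimes>\<^bsub>free_product G H\<^esub> B \<otimes>\<^bsub>free_product G H\<^esub> C =
        A \<otimes>\<^bsub>free_product G H\<^esub> (B \<otimes>\<^bsub>free_product G H\<^esub> C)"
    unfolding u(2) v(2) w(2)
    using mc[OF u(1) v(1)] mc[OF v(1) w(1)] mc[of "u @ v" w] mc[of u "v @ w"] u v w by simp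
qed

lemma fp_inl_hom:
  assumes "group G" "group H"
  shows "fp_inl G H \<in> hom G (free_product G H)"
proof (rule homI)
  fix a assume a: "a \<in> carrier G"
  show "fp_inl G H a \<in> carrier (free_product G H)"
    unfolding fp_inl_def using a by (intro fp_class_carrier) auto
  fix b assume b: "b \<in> carrier G"
  have "([Inl a, Inl b], [Inl (a \<otimes>\<^bsub>G\<^esub> b)]) \<in> fp_rel G H"
    using fp_rel.mult_left[of "[]" G H "[]" a b] a b by simp
  then show "fp_inl G H (a \<otimes>\<^bsub>G\<^esub> b) = fp_inl G H a \<otimes>\<^bsub>free_product G H\<^esub> fp_inl G H b"
    unfolding fp_inl_def
    using fp_mult_class[OF assms, of "[Inl a]" "[Inl b]"] a b
      equiv_class_eq[OF equiv_fp_rel[OF assms]] by force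
qed

lemma fp_inr_hom:
  assumes "group G" "group H"
  shows "fp_inr G H \<in> hom H (free_product G H)"
proof (rule homI)
  fix a assume a: "a \<in> carrier H"
  show "fp_inr G H a \<in> carrier (free_product G H)"
    unfolding fp_inr_def using a by (intro fp_class_carrier) auto
  fix b assume b: "b \<in> carrier H"
  have "([Inr a, Inr b], [Inr (a \<otimes>\<^bsub>H\<^esub> b)]) \<in> fp_rel G H"
    using fp_rel.mult_right[of "[]" G H "[]" a b] a b by simp
  then show "fp_inr G H (a \<otimes>\<^bsub>H\<^esub> b) = fp_inr G H a \<otimes>\<^bsub>free_product G H\<^esub> fp_inr G H b"
    unfolding fp_inr_def
    using fp_mult_class[OF assms, of "[Inr a]" "[Inr b]"] a b
      equiv_class_eq[OF equiv_fp_rel[OF assms]] by force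
qed

primrec fp_eval :: "('k, 'e) monoid_scheme \<Rightarrow> ('a \<Rightarrow> 'k) \<Rightarrow> ('b \<Rightarrow> 'k) \<Rightarrow> ('a + 'b) list \<Rightarrow> 'k" where
  "fp_eval K f g [] = \<one>\<^bsub>K\<^esub>"
| "fp_eval K f g (s # u) = case_sum f g s \<otimes>\<^bsub>K\<^esub> fp_eval K f g u"

lemma fp_eval_closed:
  assumes "group K" "f \<in> hom G K" "g \<in> hom H K" "u \<in> fp_words G H"
  shows "fp_eval K f g u \<in> carrier K"
proof -
  interpret K: group K by fact
  show ?thesis using assms(4)
    by (induction u) (auto simp: hom_in_carrier[OF assms(2)] hom_in_carrier[OF assms(3)])
qed

lemma fp_eval_append:
  assumes "group K" "f \<in> hom G K" "g \<in> hom H K" "u \<in> fp_words G H" "v \<in> fp_words G H"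
  shows "fp_eval K f g (u @ v) = fp_eval K f g u \<otimes>\<^bsub>K\<^esub> fp_eval K f g v"
proof -
  interpret K: group K by fact
  show ?thesis using assms(4)
  proof (induction u)
    case Nil
    then show ?case using fp_eval_closed[OF assms(1-3,5)] by simp
  next
    case (Cons s u)
    then have "case_sum f g s \<in> carrier K"
      by (auto simp: hom_in_carrier[OF assms(2)] hom_in_carrier[OF assms(3)])
    with Cons show ?case
      using fp_eval_closed[OF assms(1-3,5)] fp_eval_closed[OF assms(1-3), of u]
      by (auto simp: K.m_assoc)
  qed
qed

lemma fp_eval_cong:
  assumes "group G" "group H" "group K" "f \<in> hom G K" "g \<in> hom H K" "(u, v) \<in> fp_rel G H"
  shows "fp_eval K f g u = fp_eval K f g v"
proof -
  interpret G: group G by fact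
  interpret H: group H by fact
  interpret K: group K by fact
  note ap = fp_eval_append[OF assms(3-5)]
  note cl = fp_eval_closed[OF assms(3-5)]
  have 1: "f \<one>\<^bsub>G\<^esub> = \<one>\<^bsub>K\<^esub>" "g \<one>\<^bsub>H\<^esub> = \<one>\<^bsub>K\<^esub>"
    using assms(1-5) hom_one by blast+
  show ?thesis using assms(6)
  proof induction
    case (one_left u v)
    then show ?case using ap[of u "Inl \<one>\<^bsub>G\<^esub> # v"] ap[of u v] cl[of v] 1 by (simp add: InlI InrI)
  next
    case (one_right u v)
    then show ?case using ap[of u "Inr \<one>\<^bsub>H\<^esub> # v"] ap[of u v] cl[of v] 1 by (simp add: InlI InrI)
  next
    case (mult_left u v a b)
    then show ?case
      using ap[of u "Inl a # Inl b # v"] ap[of u "Inl (a \<otimes>\<^bsub>G\<^esub> b) # v"] cl[of v]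
      by (simp add: InlI hom_mult[OF assms(4)] K.m_assoc hom_in_carrier[OF assms(4)])
  next
    case (mult_right u v a b)
    then show ?case
      using ap[of u "Inr a # Inr b # v"] ap[of u "Inr (a \<otimes>\<^bsub>H\<^esub> b) # v"] cl[of v]
      by (simp add: InrI hom_mult[OF assms(5)] K.m_assoc hom_in_carrier[OF assms(5)])
  qed auto
qed

theorem free_product_universal:
  assumes "group G" "group H" "group K" "f \<in> hom G K" "g \<in> hom H K"
  shows "\<exists>!h. h \<in> hom (free_product G H) K \<and> h \<in> extensional (carrier (free_product G H)) \<and>
    (\<forall>a\<in>carrier G. h (fp_inl G H a) = f a) \<and> (\<forall>b\<in>carrier H. h (fp_inr G H b) = g b)"
proof -
  interpret G: group G by fact
  interpret H: group H by fact
  interpret K: group K by fact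
  let ?P = "free_product G H"
  note eq = equiv_fp_rel[OF assms(1,2)]
  have char: "h (fp_rel G H `` {u}) = fp_eval K f g u"
    if h: "h \<in> hom ?P K" "\<forall>a\<in>carrier G. h (fp_inl G H a) = f a"
      "\<forall>b\<in>carrier H. h (fp_inr G H b) = g b" and u: "u \<in> fp_words G H" for h u
    using u
  proof (induction u)
    case Nil
    then show ?case
      using hom_one[OF h(1) group_free_product[OF assms(1,2)] assms(3)]
      by (simp add: free_product_def)
  next
    case (Cons s u)
    then have s: "[s] \<in> fp_words G H" and u: "u \<in> fp_words G H" by auto
    have "fp_rel G H `` {s # u} = fp_rel G H `` {[s]} \<otimes>\<^bsub>?P\<^esub> fp_rel G H `` {u}"
      using fp_mult_class[OF assms(1,2) s u] by simp
    moreover have "h (fp_rel G H `` {[s]}) = case_sum f g s"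
      using h(2,3) s by (cases s) (auto simp: fp_inl_def fp_inr_def)
    ultimately show ?case
      using hom_mult[OF h(1) fp_class_carrier[OF s] fp_class_carrier[OF u]] Cons by simp
  qed
  define h where "h = (\<lambda>A\<in>carrier ?P. fp_eval K f g (SOME u. u \<in> A))"
  have h_class: "h (fp_rel G H `` {u}) = fp_eval K f g u" if u: "u \<in> fp_words G H" for u
  proof -
    have "(u, SOME v. v \<in> fp_rel G H `` {u}) \<in> fp_rel G H"
      using someI[of "\<lambda>v. v \<in> fp_rel G H `` {u}" u] fp_rel.refl[OF u] by simp
    then show ?thesis
      using fp_eval_cong[OF assms] fp_class_carrier[OF u] by (simp add: h_def)
  qed
  show ?thesis
  proof (rule ex1I[of _ h], intro conjI ballI)
    show "h \<in> hom ?P K"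
    proof (rule homI)
      fix A assume "A \<in> carrier ?P"
      then obtain u where u: "u \<in> fp_words G H" "A = fp_rel G H `` {u}" by (rule fp_carrierE)
      show "h A \<in> carrier K" unfolding u(2) h_class[OF u(1)] by (rule fp_eval_closed[OF assms(3-5) u(1)])
      fix B assume "B \<in> carrier ?P"
      then obtain v where v: "v \<in> fp_words G H" "B = fp_rel G H `` {v}" by (rule fp_carrierE)
      show "h (A \<otimes>\<^bsub>?P\<^esub> B) = h A \<otimes>\<^bsub>K\<^esub> h B"
        using fp_mult_class[OF assms(1,2) u(1) v(1)] h_class[of "u @ v"] h_class[of u] h_class[of v]
          fp_eval_append[OF assms(3-5) u(1) v(1)] u v by simp
    qed
    show "h \<in> extensional (carrier ?P)" by (simp add: h_def)
    show "h (fp_inl G H a) = f a" if "a \<in> carrier G" for a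
      unfolding fp_inl_def using that h_class[of "[Inl a]"] hom_in_carrier[OF assms(4)]
      by (simp add: InlI)
    show "h (fp_inr G H b) = g b" if "b \<in> carrier H" for b
      unfolding fp_inr_def using that h_class[of "[Inr b]"] hom_in_carrier[OF assms(5)]
      by (simp add: InrI)
  next
    fix h' assume h': "h' \<in> hom ?P K \<and> h' \<in> extensional (carrier ?P) \<and>
      (\<forall>a\<in>carrier G. h' (fp_inl G H a) = f a) \<and> (\<forall>b\<in>carrier H. h' (fp_inr G H b) = g b)"
    show "h' = h"
    proof (rule extensionalityI[of _ "carrier ?P"])
      show "h' \<in> extensional (carrier ?P)" using h' by blast
      show "h \<in> extensional (carrier ?P)" by (simp add: h_def)
      fix A assume "A \<in> carrier ?P"
      then obtain u where u: "u \<in> fp_words G H" "A = fp_rel G H `` {u}" by (rule fp_carrierE)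
      show "h' A = h A" unfolding u(2) using char[OF _ _ _ u(1)] h' h_class[OF u(1)] by simp
    qed
  qed
qed

abbreviation adjoin_free :: "('a, 'c) monoid_scheme \<Rightarrow> ('a + int) list set monoid"
  where "adjoin_free G \<equiv> free_product G integer_group"

abbreviation adjoin_const :: "('a, 'c) monoid_scheme \<Rightarrow> 'a \<Rightarrow> ('a + int) list set"
  where "adjoin_const G \<equiv> fp_inl G integer_group"

abbreviation adjoin_var :: "('a, 'c) monoid_scheme \<Rightarrow> ('a + int) list set"
  where "adjoin_var G \<equiv> fp_inr G integer_group 1"

text \<open>Homomorphisms are only determined on the carrier, so uniqueness requires fixing the value
  elsewhere; this is the purpose of \<^const>\<open>extensional\<close>.\<close>

definition ev :: "('a, 'c) monoid_scheme \<Rightarrow> 'a \<Rightarrow> ('a + int) list set \<Rightarrow> 'a" where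
  "ev G g = (THE h. h \<in> hom (adjoin_free G) G \<and> h \<in> extensional (carrier (adjoin_free G)) \<and>
     (\<forall>a\<in>carrier G. h (adjoin_const G a) = a) \<and> h (adjoin_var G) = g)"

lemma ev_ex1:
  assumes "group G" "g \<in> carrier G"
  shows "\<exists>!h. h \<in> hom (adjoin_free G) G \<and> h \<in> extensional (carrier (adjoin_free G)) \<and>
    (\<forall>a\<in>carrier G. h (adjoin_const G a) = a) \<and> h (adjoin_var G) = g"
proof -
  interpret G: group G by fact
  let ?P = "adjoin_free G" and ?r = "fp_inr G integer_group"
  have r: "?r \<in> hom integer_group ?P"
    by (rule fp_inr_hom) (use assms in auto)
  have "(h (?r 1) = g) \<longleftrightarrow> (\<forall>n\<in>carrier integer_group. h (?r n) = g [^]\<^bsub>G\<^esub> n)"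
    if h: "h \<in> hom ?P G" for h
  proof
    have hr: "h \<circ> ?r \<in> hom integer_group G" by (rule hom_compose[OF r h])
    assume *: "h (?r 1) = g"
    have "h (?r n) = g [^]\<^bsub>G\<^esub> n" for n :: int
      using hom_int_pow[OF hr, of 1 n] assms(1) * by simp
    then show "\<forall>n\<in>carrier integer_group. h (?r n) = g [^]\<^bsub>G\<^esub> n" by blast
  next
    assume "\<forall>n\<in>carrier integer_group. h (?r n) = g [^]\<^bsub>G\<^esub> n"
    then show "h (?r 1) = g" using assms(2) by (metis G.int_pow_1 UNIV_I carrier_integer_group)
  qed
  then show ?thesis
    using free_product_universal[OF assms(1) group_integer_group assms(1), of "\<lambda>a. a" "\<lambda>n. g [^]\<^bsub>G\<^esub> n"]
      G.hom_integer_group_pow[OF assms(2)] by (auto simp: hom_def cong: conj_cong)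
qed

lemma ev_props:
  assumes "group G" "g \<in> carrier G"
  shows ev_hom: "ev G g \<in> hom (adjoin_free G) G"
    and ev_const: "a \<in> carrier G \<Longrightarrow> ev G g (adjoin_const G a) = a"
    and ev_var: "ev G g (adjoin_var G) = g"
  using theI'[OF ev_ex1[OF assms]] unfolding ev_def[symmetric] by blast+

definition elementary_algebraic :: "('a, 'c) monoid_scheme \<Rightarrow> ('a + int) list set \<Rightarrow> 'a set" where
  "elementary_algebraic G w = {g \<in> carrier G. ev G g w = \<one>\<^bsub>G\<^esub>}"

text \<open>The carrier itself has to be listed among the generators: in the trivial group the sets
  below are all empty, so that they do not cover it.\<close>

definition zariski_topology :: "('a, 'c) monoid_scheme \<Rightarrow> 'a topology" where
  "zariski_topology G = topology_generated_by
     (insert (carrier G)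
       {carrier G - elementary_algebraic G w | w. w \<in> carrier (adjoin_free G)})"

definition hausdorff_group_topology :: "('a, 'c) monoid_scheme \<Rightarrow> 'a topology \<Rightarrow> bool" where
  "hausdorff_group_topology G T \<longleftrightarrow>
     topspace T = carrier G \<and> Hausdorff_space T \<and>
     continuous_map (prod_topology T T) T (\<lambda>(x, y). x \<otimes>\<^bsub>G\<^esub> y) \<and>
     continuous_map T T (\<lambda>x. inv\<^bsub>G\<^esub> x)"

definition markov_topology :: "('a, 'c) monoid_scheme \<Rightarrow> 'a topology" where
  "markov_topology G = topology (\<lambda>U. U \<subseteq> carrier G \<and>
     (\<forall>T. hausdorff_group_topology G T \<longrightarrow> closedin T (carrier G - U)))"

lemma topspace_zariski_topology [simp]: "topspace (zariski_topology G) = carrier G"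
  by (auto simp: zariski_topology_def)

lemma closedin_zariski_elementary_algebraic:
  assumes "w \<in> carrier (adjoin_free G)"
  shows "closedin (zariski_topology G) (elementary_algebraic G w)"
  unfolding closedin_def topspace_zariski_topology
proof
  show "elementary_algebraic G w \<subseteq> carrier G" by (auto simp: elementary_algebraic_def)
  show "openin (zariski_topology G) (carrier G - elementary_algebraic G w)"
    unfolding zariski_topology_def by (rule topology_generated_by_Basis) (use assms in auto)
qed

lemma zariski_topology_coarsest:
  assumes "topspace T = carrier G"
    and "\<And>w. w \<in> carrier (adjoin_free G) \<Longrightarrow> closedin T (elementary_algebraic G w)"
    and "openin (zariski_topology G) U"
  shows "openin T U"
proof -
  have "openin T V"
    if "V \<in> insert (carrier G)
       {carrier G - elementary_algebraic G w | w. w \<in> carrier (adjoin_free G)}" for V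
    using that assms(1,2) openin_topspace[of T] by (auto simp: closedin_def)
  moreover have "generate_topology_on (insert (carrier G)
       {carrier G - elementary_algebraic G w | w. w \<in> carrier (adjoin_free G)}) U"
    using assms(3) by (simp add: zariski_topology_def openin_topology_generated_by_iff)
  ultimately show ?thesis
    using generate_topology_on_coarsest[OF istopology_openin, of _ T U] by blast
qed

lemma openin_markov_topology:
  "openin (markov_topology G) U \<longleftrightarrow> U \<subseteq> carrier G \<and>
     (\<forall>T. hausdorff_group_topology G T \<longrightarrow> closedin T (carrier G - U))"
proof -
  have *: "U \<subseteq> carrier G \<and> (\<forall>T. hausdorff_group_topology G T \<longrightarrow> closedin T (carrier G - U)) \<longleftrightarrow>
    U \<subseteq> carrier G \<and> (\<forall>T. hausdorff_group_topology G T \<longrightarrow> openin T U)" for U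
    by (auto simp: hausdorff_group_topology_def closedin_def double_diff)
  have "istopology (\<lambda>U. U \<subseteq> carrier G \<and>
     (\<forall>T. hausdorff_group_topology G T \<longrightarrow> closedin T (carrier G - U)))"
    unfolding * by (auto simp: istopology_def)
  then show ?thesis unfolding markov_topology_def by simp
qed

lemma topspace_markov_topology [simp]: "topspace (markov_topology G) = carrier G"
proof
  show "topspace (markov_topology G) \<subseteq> carrier G"
    using openin_topspace[of "markov_topology G"] unfolding openin_markov_topology by blast
  show "carrier G \<subseteq> topspace (markov_topology G)"
    by (rule openin_subset) (simp add: openin_markov_topology)
qed

lemma closedin_markov_topology:
  "closedin (markov_topology G) C \<longleftrightarrow> C \<subseteq> carrier G \<and>
     (\<forall>T. hausdorff_group_topology G T \<longrightarrow> closedin T C)"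
  unfolding closedin_def[of "markov_topology G"] topspace_markov_topology openin_markov_topology
  by (auto simp: double_diff)

definition MZ_group :: "('a, 'c) monoid_scheme \<Rightarrow> bool" where
  "MZ_group G \<longleftrightarrow> group G \<and> markov_topology G = zariski_topology G"

end

theory Submission
  imports Defs "HOL-Algebra.Bij" "HOL-Combinatorics.Transposition"
begin

text \<open>
  By Cayley's theorem \<open>G\<close> embeds into the group \<open>BijGroup (carrier G)\<close> of all permutations of its
  carrier, so it suffices that the symmetric group of any set \<open>S\<close> is in the class. Evaluating a word
  at a variable element is continuous in every Hausdorff group topology, hence the Zariski topology is
  coarser than the Markov topology, which in turn is coarser than every Hausdorff group topology. Both
  coincide as soon as the Zariski topology refines one single Hausdorff group topology
  (\<open>MZ_groupI\<close>).

  If \<open>S\<close> is finite, so is the symmetric group; since points are Zariski closed, its Zariski topology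
  is discrete. If \<open>S\<close> is infinite, the topology of pointwise convergence serves. It is generated by
  the sets \<open>{f. f a = c}\<close>, and these are Zariski open because of transpositions. The conjugate
  \<open>f (a b) f\<inverse>\<close> is the transposition of \<open>f a\<close> and \<open>f b\<close>, and two transpositions fail to commute
  exactly if they share a single point. For fixed \<open>a, b, c, d\<close>, that \<open>f (a b) f\<inverse>\<close> does not commute
  with \<open>(c d)\<close> is the negation of an equation in \<open>f\<close>, that is, a Zariski open condition. Three different
  values of \<open>d\<close> force the shared point to be \<open>c\<close>, which makes \<open>c \<in> {f a, f b}\<close> a Zariski
  open condition; two different values of \<open>b\<close> then isolate \<open>f a = c\<close>.
\<close>

section \<open>Word maps and Hausdorff group topologies\<close>

lemma continuous_map_group_mult:
  assumes "hausdorff_group_topology G T" "continuous_map X T f" "continuous_map X T g"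
  shows "continuous_map X T (\<lambda>x. f x \<otimes>\<^bsub>G\<^esub> g x)"
proof -
  have "continuous_map (prod_topology T T) T (\<lambda>(x, y). x \<otimes>\<^bsub>G\<^esub> y)"
    using assms(1) by (simp add: hausdorff_group_topology_def)
  from continuous_map_compose[OF continuous_map_pairedI[OF assms(2,3)] this]
  show ?thesis by (simp add: o_def)
qed

lemma continuous_map_group_inv:
  assumes "hausdorff_group_topology G T" "continuous_map X T f"
  shows "continuous_map X T (\<lambda>x. inv\<^bsub>G\<^esub> (f x))"
  using continuous_map_compose[OF assms(2), of T "m_inv G"] assms(1)
  by (simp add: hausdorff_group_topology_def o_def)

lemma continuous_map_group_int_pow:
  assumes "group G" "hausdorff_group_topology G T"
  shows "continuous_map T T (\<lambda>x. x [^]\<^bsub>G\<^esub> (n :: int))"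
proof -
  interpret group G by fact
  have nat: "continuous_map T T (\<lambda>x. x [^]\<^bsub>G\<^esub> (k :: nat))" for k
  proof (induction k)
    case 0
    then show ?case using assms(2) by (simp add: hausdorff_group_topology_def)
  next
    case (Suc k)
    then show ?case
      using continuous_map_group_mult[OF assms(2) Suc continuous_map_id[unfolded id_def]] by simp
  qed
  show ?thesis
  proof (cases "n < 0")
    case True
    then have "(\<lambda>x. x [^]\<^bsub>G\<^esub> n) = (\<lambda>x. inv\<^bsub>G\<^esub> (x [^]\<^bsub>G\<^esub> nat (- n)))"
      by (intro ext) (simp only: int_pow_def2 if_True if_False)
    with continuous_map_group_inv[OF assms(2) nat] show ?thesis by metis
  next
    case False
    then have "(\<lambda>x. x [^]\<^bsub>G\<^esub> n) = (\<lambda>x. x [^]\<^bsub>G\<^esub> nat n)"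
      by (intro ext) (simp only: int_pow_def2 if_True if_False)
    with nat show ?thesis by metis
  qed
qed

lemma ev_mult:
  assumes "group G" "g \<in> carrier G" "u \<in> carrier (adjoin_free G)" "v \<in> carrier (adjoin_free G)"
  shows "ev G g (u \<otimes>\<^bsub>adjoin_free G\<^esub> v) = ev G g u \<otimes>\<^bsub>G\<^esub> ev G g v"
  using hom_mult[OF ev_hom[OF assms(1,2)] assms(3,4)] .

lemma ev_inv:
  assumes "group G" "g \<in> carrier G" "u \<in> carrier (adjoin_free G)"
  shows "ev G g (inv\<^bsub>adjoin_free G\<^esub> u) = inv\<^bsub>G\<^esub> (ev G g u)"
proof -
  interpret group_hom "adjoin_free G" G "ev G g"
    using assms(1,2) by (simp add: group_hom_def group_hom_axioms_def group_free_product ev_hom)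
  show ?thesis using assms(3) by simp
qed

lemma adjoin_var_carrier: "group G \<Longrightarrow> adjoin_var G \<in> carrier (adjoin_free G)"
  using hom_in_carrier[OF fp_inr_hom[OF _ group_integer_group], of G 1] by simp

lemma adjoin_const_carrier:
  "group G \<Longrightarrow> a \<in> carrier G \<Longrightarrow> adjoin_const G a \<in> carrier (adjoin_free G)"
  using hom_in_carrier[OF fp_inl_hom[OF _ group_integer_group], of G a] by simp

lemma ev_adjoin_power:
  assumes "group G" "g \<in> carrier G"
  shows "ev G g (fp_inr G integer_group n) = g [^]\<^bsub>G\<^esub> n"
proof -
  have "ev G g \<circ> fp_inr G integer_group \<in> hom integer_group G"
    by (rule hom_compose[OF fp_inr_hom ev_hom]) (use assms in auto)
  from hom_int_pow[OF this, of 1 n] show ?thesis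
    using assms by (simp add: ev_var)
qed

text \<open>On a representing word, evaluation is a product of constants and integer powers of the variable
  element, each of which depends continuously on that element.\<close>

lemma continuous_map_ev:
  assumes "group G" "hausdorff_group_topology G T" "w \<in> carrier (adjoin_free G)"
  shows "continuous_map T T (\<lambda>g. ev G g w)"
proof -
  interpret group G by fact
  have top: "topspace T = carrier G" using assms(2) by (simp add: hausdorff_group_topology_def)
  obtain u where u: "u \<in> fp_words G integer_group" and w: "w = fp_rel G integer_group `` {u}"
    using assms(3) by (rule fp_carrierE)
  have transfer: "continuous_map T T f"
    if "continuous_map T T h" "\<And>g. g \<in> carrier G \<Longrightarrow> f g = h g" for f h
    using continuous_map_eq[OF that(1)] that(2) top by metis
  have "continuous_map T T (\<lambda>g. ev G g (fp_rel G integer_group `` {u}))" using u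
  proof (induction u)
    case Nil
    have "ev G g (fp_rel G integer_group `` {[]}) = \<one>\<^bsub>G\<^esub>" if "g \<in> carrier G" for g
      using hom_one[OF ev_hom[OF assms(1) that] group_free_product assms(1)] assms(1)
      by (simp add: free_product_def)
    then show ?case
      by (rule transfer[of "\<lambda>_. \<one>\<^bsub>G\<^esub>", rotated]) (simp_all add: top)
  next
    case (Cons s u)
    then have s: "[s] \<in> fp_words G integer_group" and u: "u \<in> fp_words G integer_group" by auto
    have letter: "continuous_map T T (\<lambda>g. ev G g (fp_rel G integer_group `` {[s]}))"
    proof (cases s)
      case (Inl a)
      with s have a: "a \<in> carrier G" by auto
      then have "ev G g (fp_rel G integer_group `` {[s]}) = a" if "g \<in> carrier G" for g
        using ev_const[OF assms(1) that a] Inl by (simp add: fp_inl_def)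
      then show ?thesis
        by (rule transfer[of "\<lambda>_. a", rotated]) (simp_all add: top a)
    next
      case (Inr n)
      then have "ev G g (fp_rel G integer_group `` {[s]}) = g [^]\<^bsub>G\<^esub> n" if "g \<in> carrier G" for g
        using ev_adjoin_power[OF assms(1) that, of n] by (simp add: fp_inr_def)
      then show ?thesis
        by (rule transfer[OF continuous_map_group_int_pow[OF assms(1,2)]])
    qed
    have "ev G g (fp_rel G integer_group `` {s # u}) =
        ev G g (fp_rel G integer_group `` {[s]}) \<otimes>\<^bsub>G\<^esub> ev G g (fp_rel G integer_group `` {u})"
      if "g \<in> carrier G" for g
      using ev_mult[OF assms(1) that fp_class_carrier[OF s] fp_class_carrier[OF u]]
        fp_mult_class[OF assms(1) group_integer_group s u] by simp
    then show ?case
      by (rule transfer[OF continuous_map_group_mult[OF assms(2) letter Cons.IH]])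
  qed
  then show ?thesis by (simp add: w)
qed

text \<open>The Markov topology is squeezed between the Zariski topology and every Hausdorff group topology,
  so a single Hausdorff group topology below the Zariski topology makes all three equal.\<close>

lemma MZ_groupI:
  assumes "group G" "hausdorff_group_topology G T"
    and coarser: "\<And>U. openin T U \<Longrightarrow> openin (zariski_topology G) U"
  shows "MZ_group G"
proof -
  interpret group G by fact
  have elementary: "closedin T' (elementary_algebraic G w)"
    if "hausdorff_group_topology G T'" "w \<in> carrier (adjoin_free G)" for T' w
  proof -
    have "topspace T' = carrier G" "closedin T' {\<one>\<^bsub>G\<^esub>}"
      using that(1) by (auto simp: hausdorff_group_topology_def closedin_Hausdorff_singleton)
    then show ?thesis
      using closedin_continuous_map_preimage[OF continuous_map_ev[OF assms(1) that], of "{\<one>\<^bsub>G\<^esub>}"]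
      by (simp add: elementary_algebraic_def)
  qed
  have "openin (markov_topology G) U \<longleftrightarrow> openin (zariski_topology G) U" for U
  proof
    assume "openin (markov_topology G) U"
    then have "U \<subseteq> carrier G" "closedin T (carrier G - U)"
      using assms(2) by (auto simp: openin_markov_topology)
    moreover have "topspace T = carrier G"
      using assms(2) by (simp add: hausdorff_group_topology_def)
    ultimately show "openin (zariski_topology G) U"
      using coarser by (simp add: closedin_def double_diff)
  next
    assume U: "openin (zariski_topology G) U"
    then have "U \<subseteq> carrier G" using openin_subset by fastforce
    moreover have "closedin T' (carrier G - U)" if T': "hausdorff_group_topology G T'" for T'
    proof -
      have top: "topspace T' = carrier G" using T' by (simp add: hausdorff_group_topology_def)
      have "openin T' U"
        by (rule zariski_topology_coarsest[OF top elementary[OF T'] U])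
      then show ?thesis using top by (metis closedin_diff closedin_topspace)
    qed
    ultimately show "openin (markov_topology G) U"
      by (simp add: openin_markov_topology)
  qed
  then show ?thesis using assms(1) by (simp add: MZ_group_def topology_eq)
qed

lemma closedin_zariski_equation:
  assumes "group G" "u \<in> carrier (adjoin_free G)" "v \<in> carrier (adjoin_free G)"
  shows "closedin (zariski_topology G) {g \<in> carrier G. ev G g u = ev G g v}"
proof -
  interpret group G by fact
  interpret F: group "adjoin_free G" using assms(1) by (simp add: group_free_product)
  let ?w = "u \<otimes>\<^bsub>adjoin_free G\<^esub> inv\<^bsub>adjoin_free G\<^esub> v"
  have "ev G g ?w = \<one>\<^bsub>G\<^esub> \<longleftrightarrow> ev G g u = ev G g v" if g: "g \<in> carrier G" for g
  proof -
    have "ev G g u \<in> carrier G" "ev G g v \<in> carrier G"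
      using hom_in_carrier[OF ev_hom[OF assms(1) g]] assms by auto
    then have "ev G g u \<otimes>\<^bsub>G\<^esub> inv\<^bsub>G\<^esub> (ev G g v) = \<one>\<^bsub>G\<^esub> \<longleftrightarrow> ev G g u = ev G g v"
      by (metis inv_closed inv_equality inv_inv r_inv)
    then show ?thesis
      using ev_mult[OF assms(1) g assms(2), of "inv\<^bsub>adjoin_free G\<^esub> v"] ev_inv[OF assms(1) g assms(3)]
        assms(3) by simp
  qed
  then have "elementary_algebraic G ?w = {g \<in> carrier G. ev G g u = ev G g v}"
    by (auto simp: elementary_algebraic_def)
  then show ?thesis
    using closedin_zariski_elementary_algebraic[of ?w G] assms by simp
qed

text \<open>Commuting with \<open>t\<close> is an equation in \<open>g\<close>: both sides are values at \<open>g\<close> of words that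
  contain the conjugate \<open>x s x\<inverse>\<close> of \<open>s\<close> by the variable.\<close>

lemma openin_zariski_conj_noncommuting:
  assumes "group G" "s \<in> carrier G" "t \<in> carrier G"
  shows "openin (zariski_topology G)
    {g \<in> carrier G. (g \<otimes>\<^bsub>G\<^esub> s \<otimes>\<^bsub>G\<^esub> inv\<^bsub>G\<^esub> g) \<otimes>\<^bsub>G\<^esub> t \<noteq> t \<otimes>\<^bsub>G\<^esub> (g \<otimes>\<^bsub>G\<^esub> s \<otimes>\<^bsub>G\<^esub> inv\<^bsub>G\<^esub> g)}"
    (is "openin _ {g \<in> carrier G. ?l g \<noteq> ?r g}")
proof -
  let ?F = "adjoin_free G" and ?x = "adjoin_var G" and ?c = "adjoin_const G"
  interpret F: group ?F using assms(1) by (simp add: group_free_product)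
  let ?y = "?x \<otimes>\<^bsub>?F\<^esub> ?c s \<otimes>\<^bsub>?F\<^esub> inv\<^bsub>?F\<^esub> ?x"
  note cl = adjoin_var_carrier[OF assms(1)] adjoin_const_carrier[OF assms(1)]
  have y: "?y \<in> carrier ?F" using cl assms by simp
  have "ev G g (?y \<otimes>\<^bsub>?F\<^esub> ?c t) = ?l g" "ev G g (?c t \<otimes>\<^bsub>?F\<^esub> ?y) = ?r g" if "g \<in> carrier G" for g
    using that assms cl y by (simp_all add: ev_mult ev_inv ev_const ev_var)
  then have "{g \<in> carrier G. ?l g \<noteq> ?r g} = topspace (zariski_topology G) -
      {g \<in> carrier G. ev G g (?y \<otimes>\<^bsub>?F\<^esub> ?c t) = ev G g (?c t \<otimes>\<^bsub>?F\<^esub> ?y)}"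
    by auto
  moreover have "closedin (zariski_topology G)
      {g \<in> carrier G. ev G g (?y \<otimes>\<^bsub>?F\<^esub> ?c t) = ev G g (?c t \<otimes>\<^bsub>?F\<^esub> ?y)}"
    by (rule closedin_zariski_equation) (use assms cl y in auto)
  ultimately show ?thesis by (simp only: closedin_def)
qed

text \<open>Points are Zariski closed, being solution sets of \<open>x = h\<close>; in a finite group this makes every
  set Zariski open, and the discrete topology is a Hausdorff group topology.\<close>

lemma finite_MZ_group:
  assumes "group G" "finite (carrier G)"
  shows "MZ_group G"
proof (rule MZ_groupI[OF assms(1)])
  interpret group G by fact
  show "hausdorff_group_topology G (discrete_topology (carrier G))"
    by (auto simp: hausdorff_group_topology_def simp flip: prod_topology_discrete_topology)
  fix U assume "openin (discrete_topology (carrier G)) U"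
  then have U: "U \<subseteq> carrier G" by simp
  have "closedin (zariski_topology G) {h}" if h: "h \<in> carrier G" for h
  proof -
    have "{g \<in> carrier G. ev G g (adjoin_var G) = ev G g (adjoin_const G h)} = {h}"
      using h assms(1) by (auto simp: ev_var ev_const)
    with closedin_zariski_equation[OF assms(1) adjoin_var_carrier[OF assms(1)]
        adjoin_const_carrier[OF assms(1) h]] show ?thesis
      by simp
  qed
  then have "closedin (zariski_topology G) (\<Union>h\<in>carrier G - U. {h})"
    by (intro closedin_Union) (use assms(2) in auto)
  then show "openin (zariski_topology G) U"
    using U by (simp add: closedin_def double_diff)
qed


section \<open>Pointwise convergence on symmetric groups\<close>

text \<open>The subspace topology inherited from the power \<open>S\<^sup>S\<close> of the discrete space \<open>S\<close>. Listing
  the carrier among the generators matters only for empty \<open>S\<close>.\<close>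

definition pointwise_topology :: "'a set \<Rightarrow> ('a \<Rightarrow> 'a) topology" where
  "pointwise_topology S = topology_generated_by
     (insert (Bij S) {{f \<in> Bij S. f a = c} | a c. a \<in> S \<and> c \<in> S})"

lemma carrier_BijGroup: "carrier (BijGroup S) = Bij S"
  by (simp add: BijGroup_def)

lemma mult_BijGroup:
  "f \<in> Bij S \<Longrightarrow> g \<in> Bij S \<Longrightarrow> f \<otimes>\<^bsub>BijGroup S\<^esub> g = compose S f g"
  by (simp add: BijGroup_def)

lemma Bij_mem: "f \<in> Bij S \<Longrightarrow> a \<in> S \<Longrightarrow> f a \<in> S"
  using Bij_imp_funcset by fastforce

lemma Bij_eq_iff: "f \<in> Bij S \<Longrightarrow> a \<in> S \<Longrightarrow> b \<in> S \<Longrightarrow> f a = f b \<longleftrightarrow> a = b"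
  by (auto simp: Bij_def bij_betw_def inj_on_eq_iff)

lemma topspace_pointwise_topology [simp]: "topspace (pointwise_topology S) = Bij S"
  by (auto simp: pointwise_topology_def)

lemma openin_pointwise_topology_basic:
  assumes "a \<in> S" "c \<in> S"
  shows "openin (pointwise_topology S) {f \<in> Bij S. f a = c}"
  unfolding pointwise_topology_def by (rule topology_generated_by_Basis) (use assms in blast)

lemma continuous_map_pointwise_topologyI:
  assumes "\<And>x. x \<in> topspace X \<Longrightarrow> F x \<in> Bij S"
    and "\<And>a c. a \<in> S \<Longrightarrow> c \<in> S \<Longrightarrow> openin X {x \<in> topspace X. F x a = c}"
  shows "continuous_map X (pointwise_topology S) F"
  unfolding pointwise_topology_def
proof (rule continuous_on_generated_topo)
  fix U assume "U \<in> insert (Bij S) {{f \<in> Bij S. f a = c} | a c. a \<in> S \<and> c \<in> S}"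
  then consider "U = Bij S" | a c where "a \<in> S" "c \<in> S" "U = {f \<in> Bij S. f a = c}" by blast
  then show "openin X (F -` U \<inter> topspace X)"
  proof cases
    case 1
    then have "F -` U \<inter> topspace X = topspace X" using assms(1) by auto
    then show ?thesis by simp
  next
    case 2
    then have "F -` U \<inter> topspace X = {x \<in> topspace X. F x a = c}" using assms(1) by auto
    then show ?thesis using assms(2) 2 by simp
  qed
qed (use assms(1) in auto)

text \<open>The value of \<open>f g\<close> at \<open>a\<close> is determined by \<open>g a\<close> and by the value of \<open>f\<close> at the single point
  \<open>g a\<close>, and \<open>f\<inverse> a = c\<close> just says \<open>f c = a\<close>; both operations are therefore continuous.\<close>

lemma hausdorff_group_topology_pointwise:
  "hausdorff_group_topology (BijGroup S) (pointwise_topology S)"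
  unfolding hausdorff_group_topology_def
proof (intro conjI)
  let ?T = "pointwise_topology S"
  show "topspace ?T = carrier (BijGroup S)" by (simp add: carrier_BijGroup)
  show "Hausdorff_space ?T"
    unfolding Hausdorff_space_def topspace_pointwise_topology
  proof (intro allI impI)
    fix f g assume fg: "f \<in> Bij S \<and> g \<in> Bij S \<and> f \<noteq> g"
    then obtain a where a: "a \<in> S" "f a \<noteq> g a"
      using extensionalityI[of f S g] Bij_imp_extensional by blast
    with fg show "\<exists>U V. openin ?T U \<and> openin ?T V \<and> f \<in> U \<and> g \<in> V \<and> disjnt U V"
      by (intro exI[of _ "{h \<in> Bij S. h a = f a}"] exI[of _ "{h \<in> Bij S. h a = g a}"])
        (auto simp: openin_pointwise_topology_basic Bij_mem disjnt_def)
  qed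
  show "continuous_map (prod_topology ?T ?T) ?T (\<lambda>(f, g). f \<otimes>\<^bsub>BijGroup S\<^esub> g)"
  proof (rule continuous_map_pointwise_topologyI, goal_cases)
    case (1 p)
    then show ?case by (auto simp: mult_BijGroup compose_Bij)
  next
    case (2 a c)
    have "{p \<in> topspace (prod_topology ?T ?T). (case p of (f, g) \<Rightarrow> f \<otimes>\<^bsub>BijGroup S\<^esub> g) a = c} =
        (\<Union>b\<in>S. {f \<in> Bij S. f b = c} \<times> {g \<in> Bij S. g a = b})"
      using 2 by (auto simp: mult_BijGroup compose_eq Bij_mem)
    then show ?case
      using 2 by (auto simp: openin_prod_Times_iff openin_pointwise_topology_basic)
  qed
  show "continuous_map ?T ?T (\<lambda>f. inv\<^bsub>BijGroup S\<^esub> f)"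
  proof (rule continuous_map_pointwise_topologyI, goal_cases)
    case (1 f)
    then show ?case by (simp add: inv_BijGroup restrict_inv_into_Bij)
  next
    case (2 a c)
    then have "{f \<in> topspace ?T. (inv\<^bsub>BijGroup S\<^esub> f) a = c} = {f \<in> Bij S. f c = a}"
      by (auto simp: inv_BijGroup Bij_def bij_betw_def f_inv_into_f)
    then show ?case
      using 2 by (simp add: openin_pointwise_topology_basic)
  qed
qed


section \<open>Recovering point values from transpositions\<close>

definition transposition_on :: "'a set \<Rightarrow> 'a \<Rightarrow> 'a \<Rightarrow> 'a \<Rightarrow> 'a" where
  "transposition_on S a b = restrict (transpose a b) S"

lemma transposition_on_Bij:
  assumes "a \<in> S" "b \<in> S"
  shows "transposition_on S a b \<in> Bij S"
proof -
  have "bij_betw (transpose a b) S S"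
    by (rule bij_betwI[where g = "transpose a b"]) (use assms in \<open>auto simp: transpose_def\<close>)
  then show ?thesis
    by (simp add: transposition_on_def Bij_def)
qed

lemma transposition_on_apply: "x \<in> S \<Longrightarrow> transposition_on S a b x = transpose a b x"
  by (simp add: transposition_on_def)

lemma conj_transposition_on:
  assumes "f \<in> Bij S" "a \<in> S" "b \<in> S"
  shows "f \<otimes>\<^bsub>BijGroup S\<^esub> transposition_on S a b \<otimes>\<^bsub>BijGroup S\<^esub> inv\<^bsub>BijGroup S\<^esub> f =
    transposition_on S (f a) (f b)"
proof -
  interpret group "BijGroup S" by (rule group_BijGroup)
  have t: "transposition_on S a b \<in> Bij S" "transposition_on S (f a) (f b) \<in> Bij S"
    using assms by (simp_all add: transposition_on_Bij Bij_mem)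
  have "f (transpose a b x) = transpose (f a) (f b) (f x)" if "x \<in> S" for x
    using that assms by (auto simp: transpose_def Bij_eq_iff)
  then have "compose S f (transposition_on S a b) = compose S (transposition_on S (f a) (f b)) f"
    using assms
    by (intro extensionalityI[of _ S])
      (auto simp: compose_eq transposition_on_apply Bij_mem)
  then have "f \<otimes>\<^bsub>BijGroup S\<^esub> transposition_on S a b =
      transposition_on S (f a) (f b) \<otimes>\<^bsub>BijGroup S\<^esub> f"
    using assms(1) t by (simp add: mult_BijGroup)
  then show ?thesis
    using assms(1)[folded carrier_BijGroup] t[folded carrier_BijGroup] by (simp add: m_assoc)
qed

lemma transposition_on_commute_disjoint:
  assumes "a \<in> S" "b \<in> S" "c \<in> S" "d \<in> S" "{a, b} \<inter> {c, d} = {}"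
  shows "transposition_on S a b \<otimes>\<^bsub>BijGroup S\<^esub> transposition_on S c d =
    transposition_on S c d \<otimes>\<^bsub>BijGroup S\<^esub> transposition_on S a b"
proof -
  note B = transposition_on_Bij[OF assms(1,2)] transposition_on_Bij[OF assms(3,4)]
  have "transposition_on S a b (transposition_on S c d x) =
      transposition_on S c d (transposition_on S a b x)" if "x \<in> S" for x
    using that assms Bij_mem[OF B(1) that] Bij_mem[OF B(2) that]
    by (auto simp: transposition_on_apply transpose_def)
  then show ?thesis
    unfolding mult_BijGroup[OF B] mult_BijGroup[OF B(2,1)]
    by (intro extensionalityI[of _ S]) (auto simp: compose_eq)
qed

lemma transposition_on_noncommute:
  assumes "a \<in> S" "b \<in> S" "c \<in> S" "d \<in> S" "a \<noteq> b" "c \<in> {a, b}" "d \<notin> {a, b}"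
  shows "transposition_on S a b \<otimes>\<^bsub>BijGroup S\<^esub> transposition_on S c d \<noteq>
    transposition_on S c d \<otimes>\<^bsub>BijGroup S\<^esub> transposition_on S a b"
proof
  note B = transposition_on_Bij[OF assms(1,2)] transposition_on_Bij[OF assms(3,4)]
  assume "transposition_on S a b \<otimes>\<^bsub>BijGroup S\<^esub> transposition_on S c d =
    transposition_on S c d \<otimes>\<^bsub>BijGroup S\<^esub> transposition_on S a b"
  then have "transposition_on S a b (transposition_on S c d c) =
      transposition_on S c d (transposition_on S a b c)"
    using assms unfolding mult_BijGroup[OF B] mult_BijGroup[OF B(2,1)] by (metis compose_eq)
  then show False
    using assms by (auto simp: transposition_on_apply transpose_def split: if_splits)
qed

text \<open>The set is a union, over all sets \<open>D\<close> of three points, of the Zariski open conditions that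
  \<open>(f a  f b)\<close> commutes with \<open>(c d)\<close> for no \<open>d \<in> D\<close>. If \<open>c\<close> is one of \<open>f a\<close> and \<open>f b\<close>, then since
  \<open>S\<close> is infinite some \<open>D\<close> avoids both, and for \<open>d \<in> D\<close> the two transpositions share the point \<open>c\<close>
  alone. If \<open>c\<close> were neither, then noncommutation would force each of the three points \<open>d\<close> to be
  one of the two points \<open>f a\<close> and \<open>f b\<close>.\<close>

lemma openin_zariski_BijGroup_hits:
  assumes "infinite S" "a \<in> S" "b \<in> S" "a \<noteq> b" "c \<in> S"
  shows "openin (zariski_topology (BijGroup S)) {f \<in> Bij S. c \<in> {f a, f b}}"
proof -
  let ?G = "BijGroup S"
  define N where "N d = {f \<in> Bij S.
      transposition_on S (f a) (f b) \<otimes>\<^bsub>?G\<^esub> transposition_on S c d \<noteq>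
      transposition_on S c d \<otimes>\<^bsub>?G\<^esub> transposition_on S (f a) (f b)}" for d
  have N: "openin (zariski_topology ?G) (N d)" if "d \<in> S" for d
  proof -
    have "transposition_on S a b \<in> carrier ?G" "transposition_on S c d \<in> carrier ?G"
      using assms that by (simp_all add: transposition_on_Bij carrier_BijGroup)
    from openin_zariski_conj_noncommuting[OF group_BijGroup this] show ?thesis
      using assms by (simp add: N_def conj_transposition_on carrier_BijGroup cong: conj_cong)
  qed
  define \<D> where "\<D> = {D. D \<subseteq> S \<and> card D = 3}"
  have "{f \<in> Bij S. c \<in> {f a, f b}} = (\<Union>D\<in>\<D>. \<Inter>d\<in>D. N d)"
  proof (intro equalityI subsetI)
    fix f assume f: "f \<in> {f \<in> Bij S. c \<in> {f a, f b}}"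
    have "infinite (S - {f a, f b})" using assms(1) by simp
    then obtain D where D: "D \<subseteq> S - {f a, f b}" "card D = 3"
      using infinite_arbitrarily_large by metis
    have "f \<in> N d" if "d \<in> D" for d
    proof -
      have d: "d \<in> S" "d \<notin> {f a, f b}" using that D(1) by auto
      have B: "f \<in> Bij S" and "c \<in> {f a, f b}" using f by auto
      moreover have "f a \<in> S" "f b \<in> S" "f a \<noteq> f b"
        using B assms by (simp_all add: Bij_mem Bij_eq_iff)
      ultimately show ?thesis
        using transposition_on_noncommute[of "f a" S "f b" c d] d assms(5) by (simp add: N_def)
    qed
    with D show "f \<in> (\<Union>D\<in>\<D>. \<Inter>d\<in>D. N d)" by (auto simp: \<D>_def)
  next
    fix f assume "f \<in> (\<Union>D\<in>\<D>. \<Inter>d\<in>D. N d)"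
    then obtain D where D: "D \<subseteq> S" "card D = 3" "\<And>d. d \<in> D \<Longrightarrow> f \<in> N d"
      by (auto simp: \<D>_def)
    have "D \<noteq> {}" using D(2) by auto
    with D(3) have f: "f \<in> Bij S" by (auto simp: N_def)
    have "c \<in> {f a, f b}"
    proof (rule ccontr)
      assume c: "c \<notin> {f a, f b}"
      have "d \<in> {f a, f b}" if "d \<in> D" for d
        using transposition_on_commute_disjoint[of "f a" S "f b" c d] D(1) D(3)[OF that] that c f assms
        by (auto simp: N_def Bij_mem)
      then have "card D \<le> card {f a, f b}" by (intro card_mono) auto
      also have "\<dots> \<le> 2" by (simp add: card_insert_if)
      finally show False using D(2) by simp
    qed
    with f show "f \<in> {f \<in> Bij S. c \<in> {f a, f b}}" by simp
  qed
  moreover have "openin (zariski_topology ?G) (\<Inter>d\<in>D. N d)" if "D \<in> \<D>" for D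
  proof (rule openin_Inter)
    have "card D = 3" using that by (simp add: \<D>_def)
    then have "finite D" "D \<noteq> {}" using card.infinite by fastforce+
    then show "finite (N ` D)" "N ` D \<noteq> {}" by simp_all
  qed (use that N in \<open>auto simp: \<D>_def\<close>)
  ultimately show ?thesis by auto
qed

text \<open>An injective \<open>f\<close> cannot take the value \<open>c\<close> at two points \<open>b\<close> and \<open>b'\<close>. So \<open>f a = c\<close> if and
  only if \<open>c\<close> lies in both \<open>{f a, f b}\<close> and \<open>{f a, f b'}\<close>.\<close>

lemma openin_zariski_BijGroup_value:
  assumes "infinite S" "a \<in> S" "c \<in> S"
  shows "openin (zariski_topology (BijGroup S)) {f \<in> Bij S. f a = c}"
proof -
  have "infinite (S - {a})" using assms(1) by simp
  then obtain B where "B \<subseteq> S - {a}" "card B = 2" using infinite_arbitrarily_large by metis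
  then obtain b b' where b: "b \<in> S" "b' \<in> S" "b \<noteq> a" "b' \<noteq> a" "b \<noteq> b'"
    by (auto simp: card_2_iff)
  have "f a = c \<longleftrightarrow> c \<in> {f a, f b} \<and> c \<in> {f a, f b'}" if "f \<in> Bij S" for f
    using Bij_eq_iff[OF that b(1,2)] b(5) by auto
  then have eq: "{f \<in> Bij S. f a = c} =
      {f \<in> Bij S. c \<in> {f a, f b}} \<inter> {f \<in> Bij S. c \<in> {f a, f b'}}"
    by blast
  show ?thesis
    unfolding eq using assms b by (intro openin_Int openin_zariski_BijGroup_hits) simp_all
qed

lemma MZ_group_BijGroup: "MZ_group (BijGroup S)"
proof (cases "finite S")
  case True
  have "Bij S \<subseteq> S \<rightarrow>\<^sub>E S" by (auto simp: Bij_def bij_betw_def PiE_def)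
  then have "finite (carrier (BijGroup S))"
    using True by (metis carrier_BijGroup finite_PiE finite_subset)
  then show ?thesis by (rule finite_MZ_group[OF group_BijGroup])
next
  case False
  show ?thesis
  proof (rule MZ_groupI[OF group_BijGroup hausdorff_group_topology_pointwise])
    fix U assume "openin (pointwise_topology S) U"
    then have "generate_topology_on
        (insert (Bij S) {{f \<in> Bij S. f a = c} | a c. a \<in> S \<and> c \<in> S}) U"
      by (simp add: pointwise_topology_def openin_topology_generated_by_iff)
    moreover have "openin (zariski_topology (BijGroup S)) V"
      if "V \<in> insert (Bij S) {{f \<in> Bij S. f a = c} | a c. a \<in> S \<and> c \<in> S}" for V
      using that openin_zariski_BijGroup_value[OF False]
        openin_topspace[of "zariski_topology (BijGroup S)"]
      by (auto simp: carrier_BijGroup)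
    ultimately show "openin (zariski_topology (BijGroup S)) U"
      using generate_topology_on_coarsest[OF istopology_openin] by blast
  qed
qed


section \<open>Cayley's embedding\<close>

lemma (in group) Cayley_embedding:
  shows "(\<lambda>g. \<lambda>x\<in>carrier G. g \<otimes> x) \<in> hom G (BijGroup (carrier G))" (is "?L \<in> _")
    and "inj_on (\<lambda>g. \<lambda>x\<in>carrier G. g \<otimes> x) (carrier G)"
proof -
  have B: "?L g \<in> Bij (carrier G)" if g: "g \<in> carrier G" for g
  proof -
    have "bij_betw ((\<otimes>) g) (carrier G) (carrier G)"
      by (rule bij_betwI[where g = "(\<otimes>) (inv g)"]) (use g in \<open>auto simp flip: m_assoc\<close>)
    then show ?thesis by (simp add: Bij_def)
  qed
  show "?L \<in> hom G (BijGroup (carrier G))"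
  proof (rule homI)
    fix g h assume gh: "g \<in> carrier G" "h \<in> carrier G"
    show "?L (g \<otimes> h) = ?L g \<otimes>\<^bsub>BijGroup (carrier G)\<^esub> ?L h"
      unfolding mult_BijGroup[OF B[OF gh(1)] B[OF gh(2)]]
      using gh by (intro extensionalityI[of _ "carrier G"]) (auto simp: compose_eq m_assoc)
  qed (simp add: B carrier_BijGroup)
  show "inj_on ?L (carrier G)"
  proof (rule inj_onI)
    fix g h assume gh: "g \<in> carrier G" "h \<in> carrier G" and "?L g = ?L h"
    then have "?L g \<one> = ?L h \<one>" by (simp only:)
    with gh show "g = h" by simp
  qed
qed

theorem theorem2p3:
  fixes G :: "('a, 'm) monoid_scheme"
  assumes "group G"
  shows "\<exists>(H :: ('a \<Rightarrow> 'a) monoid) K. MZ_group H \<and> subgroup K H \<and> G \<cong> H\<lparr>carrier := K\<rparr>"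
proof -
  interpret group G by fact
  let ?H = "BijGroup (carrier G)" and ?L = "\<lambda>g. \<lambda>x\<in>carrier G. g \<otimes>\<^bsub>G\<^esub> x"
  interpret L: group_hom G ?H ?L
    using Cayley_embedding(1) assms
    by (simp add: group_hom_def group_hom_axioms_def group_BijGroup)
  have "?L \<in> iso G (?H\<lparr>carrier := ?L ` carrier G\<rparr>)"
    using Cayley_embedding by (auto simp: iso_def hom_def bij_betw_def)
  then have "G \<cong> ?H\<lparr>carrier := ?L ` carrier G\<rparr>" by (rule is_isoI)
  then show ?thesis using MZ_group_BijGroup L.img_is_subgroup by blast
qed

end
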